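(* Let $a,b>0$ and $\gamma=\frac{ab}{a+b}$ (so that $\gamma\in(0,a)$). Let $\hat p_4$ be a real polynomial of degree $4$ for which there is a real polynomial $\hat q_2$ of degree $2$ with $$\hat p_4^2(s)-s\left(s-\frac1a\right)\left(s+\frac1b\right)\left(s-\frac1\gamma\right)\hat q_2^2(s)=1.$$ Then $\hat p_4(s)$ equals, up to a constant multiplier, $$T_2\left(\frac{2ab^2s^2-2b^2s-(a+b)}{a+b}\right),$$ where $T_2(x)=2x^2-1$ is the second Chebyshev polynomial.
   Context: The value of $\gamma$ is the one in $(0,a)$ for which billiard trajectories within the ellipse $\frac{x^2}{a}+\frac{y^2}{b}=1$ in the Minkowski plane with caustic $\frac{x^2}{a-\gamma}+\frac{y^2}{b+\gamma}=1$ (an ellipse) are $4$-periodic. *)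

theory Defs
  imports Complex_Main "HOL-Computational_Algebra.Polynomial"
begin

text \<open>Chebyshev polynomials of the first kind.\<close>

fun chebyshev_T :: "nat \<Rightarrow> real poly" where
  "chebyshev_T 0 = 1"
| "chebyshev_T (Suc 0) = [:0, 1:]"
| "chebyshev_T (Suc (Suc n)) = [:0, 2:] * chebyshev_T (Suc n) - chebyshev_T n"

lemma poly_chebyshev_T_2: "poly (chebyshev_T 2) x = 2 * x\<^sup>2 - 1"
  by (simp add: numeral_2_eq_2 algebra_simps power2_eq_square)

lemma gamma_in_interval:
  fixes a b :: real
  assumes "a > 0" and "b > 0"
  shows "a * b / (a + b) \<in> {0<..<a}"
  using assms by (simp add: divide_simps algebra_simps)

end

theory Submission imports Defs begin

text \<open>
  The equation is a polynomial Pell equation. Put \<open>X = (2ab\<^sup>2s\<^sup>2 - 2b\<^sup>2s - (a+b))/(a+b)\<close>. Since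
  \<open>1/\<gamma> = 1/a + 1/b\<close>, the quartic coefficient is a constant multiple of \<open>X\<^sup>2 - 1\<close>, so
  \<open>T\<^sub>2(X)\<^sup>2 - (X\<^sup>2 - 1)(2X)\<^sup>2 = 1\<close> yields one solution of the required degrees. Two solutions
  \<open>(p, q)\<close> and \<open>(T, U)\<close> of equal degrees agree up to sign, by comparing degrees in
  \<open>(qT - pU)(qT + pU) = q\<^sup>2 - U\<^sup>2\<close>.
\<close>

lemma pell_poly_unique:
  fixes p q T U D :: "'a::field_char_0 poly"
  assumes pq: "p\<^sup>2 - D * q\<^sup>2 = 1" and TU: "T\<^sup>2 - D * U\<^sup>2 = 1"
    and "q \<noteq> 0" and deg: "degree q = degree U" "degree U < degree T"
  shows "p = T \<or> p = - T"
proof -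
  let ?A = "q * T - p * U" and ?B = "q * T + p * U"
  have p2: "p\<^sup>2 = 1 + D * q\<^sup>2" and T2: "T\<^sup>2 = 1 + D * U\<^sup>2"
    using pq TU by (simp_all add: algebra_simps)
  have "?A * ?B = q\<^sup>2 * T\<^sup>2 - p\<^sup>2 * U\<^sup>2"
    by (simp add: algebra_simps power2_eq_square)
  also have "\<dots> = q\<^sup>2 - U\<^sup>2"
    unfolding p2 T2 by (simp add: algebra_simps)
  finally have AB: "?A * ?B = q\<^sup>2 - U\<^sup>2" .
  have "?A * ?B = 0"
  proof (rule ccontr)
    assume nz: "?A * ?B \<noteq> 0"
    have "T \<noteq> 0" using deg by auto
    \<comment> \<open>The sum \<open>?A + ?B\<close> is twice \<open>q * T\<close>, of degree above
      \<open>2 * degree U\<close>; characteristic zero keeps the factor 2 harmless.\<close>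
    have "degree q + degree T = degree (smult 2 (q * T))"
      using \<open>q \<noteq> 0\<close> \<open>T \<noteq> 0\<close> by (simp add: degree_mult_eq)
    also have "smult 2 (q * T) = ?A + ?B"
      using smult_add_left[of 1 1 "q * T"] by simp
    also have "degree (?A + ?B) \<le> max (degree ?A) (degree ?B)"
      by (rule degree_add_le_max)
    \<comment> \<open>Degrees of nonzero factors add, so neither factor exceeds the product in
      degree.\<close>
    also have "\<dots> \<le> degree (?A * ?B)"
      using nz by (subst degree_mult_eq) auto
    also have "\<dots> \<le> 2 * degree U"
      unfolding AB using deg by (intro degree_diff_le order.trans[OF degree_power_le]) auto
    finally show False using deg by simp
  qed
  \<comment> \<open>Which factor vanishes is irrelevant: equal squares of \<open>q\<close> and
    \<open>U\<close> force equal squares of \<open>p\<close> and \<open>T\<close> through the two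
    Pell equations.\<close>
  hence "q\<^sup>2 = U\<^sup>2" using AB by simp
  hence "p\<^sup>2 = T\<^sup>2" by (simp add: p2 T2)
  thus ?thesis by (simp add: power2_eq_iff)
qed

theorem proposition8p8:
  fixes a b \<gamma> :: real and p\<^sub>4 :: "real poly"
  assumes "a > 0" and "b > 0"
    and "\<gamma> = a * b / (a + b)"
    and "degree p\<^sub>4 = 4"
    and "\<exists>q\<^sub>2 :: real poly. degree q\<^sub>2 = 2 \<and>
           (\<forall>s. (poly p\<^sub>4 s)\<^sup>2
                  - s * (s - 1 / a) * (s + 1 / b) * (s - 1 / \<gamma>) * (poly q\<^sub>2 s)\<^sup>2 = 1)"
  shows "\<exists>c. c \<noteq> 0 \<and>
           (\<forall>s. poly p\<^sub>4 s =
                  c * poly (chebyshev_T 2)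
                        ((2 * a * b\<^sup>2 * s\<^sup>2 - 2 * b\<^sup>2 * s - (a + b)) / (a + b)))"
proof -
  obtain q where q: "degree q = 2" and pell: "\<And>s. (poly p\<^sub>4 s)\<^sup>2
      - s * (s - 1 / a) * (s + 1 / b) * (s - 1 / \<gamma>) * (poly q s)\<^sup>2 = 1"
    using assms(5) by blast
  define D where "D = [:0, 1:] * [:- 1 / a, 1:] * [:1 / b, 1:] * [:- 1 / \<gamma>, 1:]"
  define m where "m = 2 * a * b\<^sup>2 / (a + b)"
  define X where "X = [:- 1, - 2 * b\<^sup>2 / (a + b), m:]"
  define T where "T = pcompose (chebyshev_T 2) X"
  \<comment> \<open>The factor \<open>m\<close> absorbs the leading coefficient of \<open>X\<close>,
    since \<open>D\<close> is monic.\<close>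
  define U where "U = smult (2 * m) X"
  have pos: "a > 0" "b > 0" "a + b > 0" and "m \<noteq> 0"
    using assms by (auto simp: m_def)
  have poly_X: "poly X s = (2 * a * b\<^sup>2 * s\<^sup>2 - 2 * b\<^sup>2 * s - (a + b)) / (a + b)" for s
    using pos by (simp add: X_def m_def divide_simps) (simp add: algebra_simps power2_eq_square)
  have poly_D: "poly D s = s * (s - 1 / a) * (s + 1 / b) * (s - 1 / \<gamma>)" for s
    unfolding D_def poly_mult by simp
  have "p\<^sub>4\<^sup>2 - D * q\<^sup>2 = 1"
    by (rule poly_ext) (simp add: poly_D pell)
  moreover have "T\<^sup>2 - D * U\<^sup>2 = 1"
  proof (rule poly_ext)
    fix s
    \<comment> \<open>Here \<open>X + 1\<close> is \<open>m * s * (s - 1 / a)\<close>, and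
      \<open>X - 1\<close> is \<open>m * (s + 1 / b) * (s - 1 / \<gamma>)\<close> because
      \<open>1 / \<gamma> = 1 / a + 1 / b\<close>.\<close>
    have eq: "m\<^sup>2 * poly D s = (poly X s)\<^sup>2 - 1"
      using pos unfolding poly_X poly_D m_def assms(3)
      by (simp add: divide_simps) (simp add: algebra_simps power2_eq_square power4_eq_xxxx)
    have "poly D s * (poly U s)\<^sup>2 = 4 * ((poly X s)\<^sup>2 - 1) * (poly X s)\<^sup>2"
      by (simp add: U_def power_mult_distrib flip: eq)
    thus "poly (T\<^sup>2 - D * U\<^sup>2) s = poly 1 s"
      by (simp add: T_def poly_pcompose poly_chebyshev_T_2 algebra_simps power2_eq_square)
  qed
  moreover have "q \<noteq> 0" using q by auto
  moreover have "degree X = 2" using \<open>m \<noteq> 0\<close> by (simp add: X_def)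
  hence "degree U = 2" "degree T = 4"
    using \<open>m \<noteq> 0\<close> by (simp_all add: U_def T_def degree_pcompose numeral_2_eq_2 one_pCons)
  ultimately have "p\<^sub>4 = T \<or> p\<^sub>4 = - T"
    using q by (intro pell_poly_unique[of p\<^sub>4 D q T U]) auto
  \<comment> \<open>The multiplier is 1 or -1.\<close>
  then obtain c :: real where "c \<noteq> 0" "p\<^sub>4 = smult c T"
    by (metis one_neq_zero neg_equal_0_iff_equal smult_1_left smult_minus_left)
  thus ?thesis by (intro exI[of _ c]) (simp add: T_def poly_pcompose poly_X)
qed

end
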